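(* Let $K\subset\mathbb R^2$ be a convex body which possesses two (distinct) equipotential circles. Then $K$ is a disc.
   Context: A convex body is a compact convex set with nonempty interior. Given a convex body $K\subset\mathbb R^2$, a circle $\Omega\subset \operatorname{int} K$ (of positive radius) is an equipotential circle of $K$ if there is a constant $\lambda$ such that for every tangent line of $\Omega$, with contact point $P$ and cutting $K$ in the chord $AB$ (with $A,B\in\partial K$), one has $|AP|\cdot|PB|=\lambda$. The constant $\lambda$ may depend on the circle. *)

theory Defs
  imports "HOL-Analysis.Analysis"
begin

definition convex_body :: "(real^2) set \<Rightarrow> bool" where
  "convex_body K \<longleftrightarrow> compact K \<and> convex K \<and> interior K \<noteq> {}"

(* A circle is the curve, not the region it bounds. *)
definition is_circle :: "(real^2) set \<Rightarrow> bool" where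
  "is_circle \<Omega> \<longleftrightarrow> (\<exists>c r. 0 < r \<and> \<Omega> = sphere c r)"

definition is_disc :: "(real^2) set \<Rightarrow> bool" where
  "is_disc K \<longleftrightarrow> (\<exists>c r. 0 < r \<and> K = cball c r)"

(* Tangency in the elementary sense for circles: a line meeting the circle in exactly one point. *)
definition tangent_line_at :: "(real^2) set \<Rightarrow> real^2 \<Rightarrow> (real^2) set \<Rightarrow> bool" where
  "tangent_line_at \<Omega> P L \<longleftrightarrow> affine L \<and> aff_dim L = 1 \<and> L \<inter> \<Omega> = {P}"

(* For a convex body K and a contact point P in its interior, the endpoints A, B of the
   chord always exist and are unique up to order, so the inner quantifier is not vacuous. *)
definition equipotential_circle :: "(real^2) set \<Rightarrow> (real^2) set \<Rightarrow> bool" where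
  "equipotential_circle K \<Omega> \<longleftrightarrow>
     is_circle \<Omega> \<and> \<Omega> \<subseteq> interior K \<and>
     (\<exists>lam::real. \<forall>L P A B.
        tangent_line_at \<Omega> P L \<and> A \<in> frontier K \<and> B \<in> frontier K \<and> L \<inter> K = closed_segment A B
        \<longrightarrow> dist A P * dist P B = lam)"

end

theory Submission
  imports Defs
begin

text \<open>
  Sending a boundary point along a tangent of an equipotential circle (centre c, radius r, constant
  lam) to the other end of the chord replaces its tangent length a by lam / a. Doing this twice
  restores the distance to c, so it is a rotation about c, by an angle depending only on a. If some
  boundary point is rotated by an irrational angle, its orbit is dense in a circle about c, which
  then lies in the boundary. Otherwise, by connectedness of the boundary, the angle is constant;
  when lam differs from r squared this leaves at most two values of a, hence one, and again K is a
  disc.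

  If lam equals r squared, the rotation is by pi and K is symmetric about c. A compact set has at
  most one centre of symmetry, so two such circles are concentric. Here a single tangent step is a
  quarter turn with dilation factor r / a, and the boundary meets each ray from c once, so the two
  radii agree as well.
\<close>

section \<open>Rays and chords through an interior point of a convex set\<close>

text \<open>The open segment from an interior point to a point of \<open>S\<close> consists of
  interior points, so no frontier point can lie on it.\<close>

lemma ray_in_convex_le_frontier:
  fixes S :: "'a::euclidean_space set"
  assumes "convex S" "p \<in> interior S" "p + t *\<^sub>R v \<in> S" "p + d *\<^sub>R v \<in> frontier S" "0 < d"
  shows "t \<le> d"
proof (rule ccontr)
  assume "\<not> t \<le> d"
  then have dt: "d < t" by simp
  have v0: "v \<noteq> 0"
    using assms(2,4) by (auto simp: frontier_def)
  have "p + d *\<^sub>R v \<in> open_segment p (p + t *\<^sub>R v)"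
    unfolding in_segment
  proof (intro conjI exI)
    show "p \<noteq> p + t *\<^sub>R v" "0 < d / t" "d / t < 1"
      using dt \<open>0 < d\<close> v0 by auto
    have "(1 - d / t) *\<^sub>R p + (d / t) *\<^sub>R (p + t *\<^sub>R v) = p + (d / t * t) *\<^sub>R v"
      by (simp only: scaleR_diff_left scaleR_add_right scaleR_scaleR scaleR_one) simp
    then show "p + d *\<^sub>R v = (1 - d / t) *\<^sub>R p + (d / t) *\<^sub>R (p + t *\<^sub>R v)"
      using dt \<open>0 < d\<close> by simp
  qed
  then have "p + d *\<^sub>R v \<in> interior S"
    using in_interior_closure_convex_segment[OF assms(1,2)] assms(3) closure_subset by blast
  then show False
    using assms(4) by (auto simp: frontier_def)
qed

text \<open>Two frontier points on opposite sides of \<open>p\<close> thus supply the chord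
  hypothesis \<open>L \<inter> K = closed_segment A B\<close> of an equipotential circle.\<close>

lemma chord_through_interior:
  fixes S :: "'a::euclidean_space set"
  assumes "convex S" "closed S" "p \<in> interior S"
    and "p - a *\<^sub>R v \<in> frontier S" "p + b *\<^sub>R v \<in> frontier S" "0 < a" "0 < b"
  shows "range (\<lambda>t. p + t *\<^sub>R v) \<inter> S = closed_segment (p - a *\<^sub>R v) (p + b *\<^sub>R v)"
proof
  have fr: "frontier S \<subseteq> S"
    using \<open>closed S\<close> by (simp add: frontier_subset_eq)
  show "range (\<lambda>t. p + t *\<^sub>R v) \<inter> S \<subseteq> closed_segment (p - a *\<^sub>R v) (p + b *\<^sub>R v)"
  proof
    fix x assume "x \<in> range (\<lambda>t. p + t *\<^sub>R v) \<inter> S"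
    then obtain t where x: "x = p + t *\<^sub>R v" and xS: "x \<in> S" by auto
    have "t \<le> b"
      using ray_in_convex_le_frontier[OF assms(1,3)] xS assms(5,7) unfolding x by blast
    moreover have "- t \<le> a"
      using ray_in_convex_le_frontier[OF assms(1,3), of "-t" "-v" a] xS assms(4,6) unfolding x by simp
    \<comment> \<open>The fraction is the affine parameter that takes \<open>- a\<close> to 0 and
      \<open>b\<close> to 1.\<close>
    ultimately have u: "0 \<le> (t + a) / (a + b)" "(t + a) / (a + b) \<le> 1"
      using assms(6,7) by (auto simp: field_simps)
    have "(1 - (t + a) / (a + b)) * (- a) + (t + a) / (a + b) * b = (t + a) / (a + b) * (a + b) - a"
      by (simp only: algebra_simps)
    also have "\<dots> = t" using assms(6,7) by simp
    finally have "x = p + ((1 - (t + a) / (a + b)) * (- a) + (t + a) / (a + b) * b) *\<^sub>R v"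
      using x by simp
    also have "\<dots> = (1 - (t + a) / (a + b)) *\<^sub>R (p - a *\<^sub>R v) + ((t + a) / (a + b)) *\<^sub>R (p + b *\<^sub>R v)"
      by (simp only: scaleR_diff_left scaleR_add_left scaleR_diff_right scaleR_add_right
         scaleR_scaleR scaleR_one scaleR_minus_left mult_minus_right) simp
    finally show "x \<in> closed_segment (p - a *\<^sub>R v) (p + b *\<^sub>R v)"
      unfolding in_segment using u by blast
  qed
  show "closed_segment (p - a *\<^sub>R v) (p + b *\<^sub>R v) \<subseteq> range (\<lambda>t. p + t *\<^sub>R v) \<inter> S"
  proof
    fix x assume x: "x \<in> closed_segment (p - a *\<^sub>R v) (p + b *\<^sub>R v)"
    then obtain u where "x = (1 - u) *\<^sub>R (p - a *\<^sub>R v) + u *\<^sub>R (p + b *\<^sub>R v)"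
      by (auto simp: in_segment)
    then have "x = p + (u * b - (1 - u) * a) *\<^sub>R v"
      by (simp add: algebra_simps)
    moreover have "x \<in> S"
      using x closed_segment_subset[OF _ _ assms(1)] fr assms(4,5) by blast
    ultimately show "x \<in> range (\<lambda>t. p + t *\<^sub>R v) \<inter> S" by blast
  qed
qed

section \<open>Orbits of rotations and roots of unity\<close>

text \<open>As no positive power of \<open>w\<close> is 1, its angle is an irrational number of full
  turns. Multiples of an irrational number are dense modulo 1, and closedness of \<open>S\<close>
  turns density into containment.\<close>

lemma closed_unit_orbit_dense:
  fixes z w :: complex
  assumes "norm w = 1" "\<And>n. n > 0 \<Longrightarrow> w ^ n \<noteq> 1" "closed S" "\<And>n. z * w ^ n \<in> S"
  shows "sphere 0 (norm z) \<subseteq> S"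
proof
  fix y :: complex assume "y \<in> sphere 0 (norm z)"
  then have ny: "norm y = norm z" by simp
  show "y \<in> S"
  proof (cases "z = 0")
    case True
    then show ?thesis using ny assms(4)[of 0] by simp
  next
    case False
    define \<theta> where "\<theta> = Arg w / (2 * pi)"
    define \<alpha> where "\<alpha> = Arg (y / z) / (2 * pi)"
    have w: "w = cis (2 * pi * \<theta>)"
      using assms(1) cis_Arg[of w] by (cases "w = 0") (auto simp: \<theta>_def sgn_eq)
    have y: "y = z * cis (2 * pi * \<alpha>)"
      using ny False cis_Arg[of "y / z"] by (cases "y = 0") (auto simp: \<alpha>_def sgn_eq norm_divide)
    have irr: "\<theta> \<notin> \<rat>"
    proof
      assume "\<theta> \<in> \<rat>"
      then obtain m n where mn: "n > 0" "\<theta> = of_int m / of_int n"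
        by (meson Rats_cases')
      have "real (nat n) * (2 * pi * \<theta>) = 2 * pi * of_int m"
        using mn by (simp add: field_simps)
      then have "w ^ nat n = cis (2 * pi * of_int m)"
        unfolding w Complex.DeMoivre by (rule arg_cong)
      also have "\<dots> = 1" by (rule cis_multiple_2pi) simp
      finally show False using assms(2)[of "nat n"] mn by simp
    qed
    show ?thesis
    proof (rule ccontr)
      assume "y \<notin> S"
      define g where "g = (\<lambda>t. z * cis (2 * pi * t))"
      have "isCont g \<alpha>" unfolding g_def cis_conv_exp by (intro continuous_intros)
      then have "(g \<longlongrightarrow> g \<alpha>) (nhds \<alpha>)"
        unfolding isCont_def tendsto_at_iff_tendsto_nhds .
      moreover have "open (- S)" "g \<alpha> \<in> - S"
        using assms(3) \<open>y \<notin> S\<close> y by (auto simp: g_def)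
      ultimately have "eventually (\<lambda>t. g t \<in> - S) (nhds \<alpha>)"
        by (rule topological_tendstoD)
      then obtain d where d: "d > 0" "\<And>t. dist t \<alpha> < d \<Longrightarrow> g t \<notin> S"
        by (auto simp: eventually_nhds_metric)
      \<comment> \<open>The integer \<open>h\<close> only removes full turns, so the approximating
        point is the orbit point \<open>z * w ^ k\<close>.\<close>
      obtain h k where hk: "k > (0::nat)" "\<bar>of_int k * \<theta> - of_int h - \<alpha>\<bar> < d"
        using sequence_of_fractional_parts_is_dense[OF irr d(1), of \<alpha>]
        by (metis of_nat_0_less_iff of_int_of_nat_eq zero_less_imp_eq_int)
      have "g (of_int k * \<theta> - of_int h) = z * (cis (2 * pi * (real k * \<theta>)) / cis (2 * pi * of_int h))"
        unfolding g_def by (simp add: cis_divide algebra_simps)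
      also have "\<dots> = z * w ^ k"
        unfolding w Complex.DeMoivre by (simp add: cis_multiple_2pi[OF Ints_of_int] mult.left_commute[of "real k"])
      finally show False
        using assms(4)[of k] d(2)[of "real k * \<theta> - of_int h"] hk by (simp add: dist_real_def)
    qed
  qed
qed

lemma countable_complex_roots_of_unity: "countable {w::complex. \<exists>n>0. w ^ n = 1}"
proof -
  have "{w::complex. \<exists>n>0. w ^ n = 1} = (\<Union>n\<in>{0<..}. {w. w ^ n = 1})" by auto
  moreover have "countable {w::complex. w ^ n = 1}" if "n \<in> {0<..}" for n
    using that finite_roots_unity[of n, where 'a=complex] by (simp add: countable_finite Suc_le_eq)
  ultimately show ?thesis by (simp only: countable_UN countableI_type)
qed

section \<open>Complex coordinates on the plane\<close>

definition plane :: "complex \<Rightarrow> real^2" where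
  "plane z = vector [Re z, Im z]"

definition plane_inv :: "real^2 \<Rightarrow> complex" where
  "plane_inv x = Complex (x $ 1) (x $ 2)"

lemma plane_plane_inv [simp]: "plane (plane_inv x) = x"
  by (simp add: plane_def plane_inv_def vec_eq_iff forall_2)

lemma plane_inv_plane [simp]: "plane_inv (plane z) = z"
  by (simp add: plane_def plane_inv_def)

lemma linear_plane: "linear plane"
  by (rule linearI) (auto simp: plane_def vec_eq_iff forall_2)

lemma linear_plane_inv: "linear plane_inv"
  by (rule linearI) (auto simp: plane_inv_def complex_eq_iff)

lemma plane_add: "plane (z + w) = plane z + plane w"
  and plane_diff: "plane (z - w) = plane z - plane w"
  and plane_minus: "plane (- z) = - plane z"
  and plane_scaleR: "plane (s *\<^sub>R z) = s *\<^sub>R plane z"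
  and plane_0 [simp]: "plane 0 = 0"
  using linear_plane by (auto simp: linear_add linear_diff linear_neg linear_scale linear_0)

lemma norm_plane [simp]: "norm (plane z) = norm z"
  by (simp add: plane_def norm_vec_def L2_set_def sum_2 cmod_def)

section \<open>A convex body with one equipotential circle\<close>

locale equipotential =
  fixes K :: "(real^2) set" and c :: "real^2" and r lam :: real
  assumes body: "convex_body K" and r_pos: "0 < r" and sphere_sub: "sphere c r \<subseteq> interior K"
    and power: "\<And>L P A B. tangent_line_at (sphere c r) P L \<Longrightarrow> A \<in> frontier K \<Longrightarrow>
      B \<in> frontier K \<Longrightarrow> L \<inter> K = closed_segment A B \<Longrightarrow> dist A P * dist P B = lam"
begin

text \<open>The centre of the circle becomes the origin, so that rotations about it are
  multiplications by unit complex numbers.\<close>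

definition bd :: "complex set" where
  "bd = {z. c + plane z \<in> frontier K}"

lemma K_props: "convex K" "compact K" "closed K" "bounded K"
  using body by (auto simp: convex_body_def compact_imp_closed compact_imp_bounded)

text \<open>The centre is the midpoint of two antipodal points of the circle, and the interior of
  \<open>K\<close> is convex.\<close>

lemma center_interior: "c \<in> interior K"
proof -
  have "c + plane r \<in> interior K" "c - plane r \<in> interior K"
    using sphere_sub r_pos by (auto simp: subset_iff dist_norm)
  moreover have "c = (1/2) *\<^sub>R (c + plane r) + (1/2) *\<^sub>R (c - plane r)"
    by (simp add: algebra_simps flip: scaleR_add_left)
  moreover have "convex (interior K)" by (simp add: K_props convex_interior)
  ultimately show ?thesis
    by (metis convexD field_sum_of_halves zero_le_divide_1_iff zero_le_numeral)
qed

lemma bd_compact: "compact bd" and bd_connected: "connected bd" and bd_nonempty: "bd \<noteq> {}"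
proof -
  have eq: "bd = (\<lambda>x. plane_inv (x - c)) ` frontier K"
  proof
    show "bd \<subseteq> (\<lambda>x. plane_inv (x - c)) ` frontier K"
    proof
      fix z assume "z \<in> bd"
      then show "z \<in> (\<lambda>x. plane_inv (x - c)) ` frontier K"
        by (intro image_eqI[of _ _ "c + plane z"]) (simp_all add: bd_def)
    qed
  qed (auto simp: bd_def)
  have cont: "continuous_on (frontier K) (\<lambda>x. plane_inv (x - c))"
    by (intro linear_continuous_on_compose[OF _ linear_plane_inv] continuous_intros)
  \<comment> \<open>The dimension matters for connectedness: the relative frontier of a segment
    would be two points.\<close>
  have "aff_dim K = 2"
    using aff_dim_nonempty_interior[of K] center_interior by auto
  then have "connected (rel_frontier K)"
    by (intro connected_sphere_gen K_props) simp
  moreover have "rel_frontier K = frontier K"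
    by (rule rel_frontier_nonempty_interior) (use center_interior in blast)
  ultimately have "connected (frontier K)" by simp
  then show "connected bd"
    unfolding eq using cont connected_continuous_image by blast
  have "compact (frontier K)"
    by (simp add: K_props compact_frontier)
  then show "compact bd"
    unfolding eq using cont compact_continuous_image by blast
  have "frontier K \<noteq> {}"
    using K_props center_interior
    by (metis bounded_empty frontier_eq_empty interior_empty empty_iff not_bounded_UNIV)
  then show "bd \<noteq> {}" unfolding eq by simp
qed

lemma bd_ray_unique:
  assumes "z \<in> bd" "s *\<^sub>R z \<in> bd" "0 < s"
  shows "s = 1"
proof -
  have fr: "frontier K \<subseteq> K" using K_props by (simp add: frontier_subset_eq)
  have "c + 1 *\<^sub>R plane z \<in> frontier K" "c + s *\<^sub>R plane z \<in> frontier K"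
    using assms by (auto simp: bd_def plane_scaleR)
  then have "s \<le> 1" "1 \<le> s"
    using ray_in_convex_le_frontier[OF K_props(1) center_interior] fr \<open>0 < s\<close>
    by (meson subsetD zero_less_one)+
  then show ?thesis by simp
qed

text \<open>Otherwise the circle point on the ray through \<open>z\<close> lies in \<open>K\<close>
  at or beyond a frontier point. This forces \<open>z\<close> onto the circle, which consists of
  interior points.\<close>

lemma norm_bd:
  assumes "z \<in> bd"
  shows "r < norm z"
proof (rule ccontr)
  assume le: "\<not> r < norm z"
  have z: "c + plane z \<in> frontier K" using assms by (simp add: bd_def)
  then have z0: "z \<noteq> 0" using center_interior by (auto simp: frontier_def)
  have "c + (r / norm z) *\<^sub>R plane z \<in> sphere c r"
    using r_pos z0 by (simp add: dist_norm)
  then have "c + (r / norm z) *\<^sub>R plane z \<in> K"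
    using sphere_sub interior_subset by blast
  then have "r / norm z \<le> 1"
    using ray_in_convex_le_frontier[OF K_props(1) center_interior, of "r / norm z" "plane z" 1] z by simp
  then have "norm z = r" using le z0 by (simp add: field_simps)
  then have "c + plane z \<in> sphere c r" by (simp add: dist_norm)
  then show False using z sphere_sub by (auto simp: frontier_def)
qed

section \<open>Tangent steps and the rotation made by two of them\<close>

text \<open>By Pythagoras, the length of a tangent segment from \<open>z\<close> to the
  circle.\<close>

definition tan_len :: "complex \<Rightarrow> real" where
  "tan_len z = sqrt ((norm z)\<^sup>2 - r\<^sup>2)"

lemma tan_len_pos: "z \<in> bd \<Longrightarrow> 0 < tan_len z"
  using norm_bd[of z] r_pos by (simp add: tan_len_def power_strict_mono)

lemma norm_sq_bd: "z \<in> bd \<Longrightarrow> (norm z)\<^sup>2 = r\<^sup>2 + (tan_len z)\<^sup>2"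
  using norm_bd[of z] r_pos by (simp add: tan_len_def power_mono)

text \<open>Radius and tangent are orthogonal, so the point with parameter \<open>t\<close> has
  distance \<open>sqrt (r\<^sup>2 + t\<^sup>2)\<close> from \<open>c\<close>, which is
  \<open>r\<close> only for \<open>t = 0\<close>.\<close>

lemma tangent_line_at_sphere:
  fixes u :: complex
  assumes "norm u = 1"
  shows "tangent_line_at (sphere c r) (c + plane (r * u))
    (range (\<lambda>t. c + plane (r * u) + t *\<^sub>R plane (\<i> * u)))"
  unfolding tangent_line_at_def
proof (intro conjI)
  let ?P = "c + plane (r * u)" and ?v = "plane (\<i> * u)"
  have L: "range (\<lambda>t. ?P + t *\<^sub>R ?v) = affine hull {?P, ?P + ?v}"
    by (simp add: affine_hull_2_alt)
  show "affine (range (\<lambda>t. ?P + t *\<^sub>R ?v))" unfolding L by simp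
  have "norm ?v = 1" using assms by (simp add: norm_mult)
  then have "?v \<noteq> 0" by (metis norm_zero zero_neq_one)
  then show "aff_dim (range (\<lambda>t. ?P + t *\<^sub>R ?v)) = 1"
    unfolding L by (simp add: aff_dim_affine_hull)
  have nrm: "dist c (?P + t *\<^sub>R ?v) = sqrt (r\<^sup>2 + t\<^sup>2)" for t
  proof -
    have "r * u + t *\<^sub>R (\<i> * u) = Complex r t * u"
      by (simp add: complex_eq_iff)
    then have "?P + t *\<^sub>R ?v = c + plane (Complex r t * u)"
      by (metis add.assoc plane_add plane_scaleR)
    then have "dist c (?P + t *\<^sub>R ?v) = norm (Complex r t * u)"
      by (simp only: dist_norm norm_minus_commute[of c]) simp
    also have "\<dots> = sqrt (r\<^sup>2 + t\<^sup>2)" using assms by (simp add: norm_mult complex_norm)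
    finally show ?thesis .
  qed
  have "t = 0" if "sqrt (r\<^sup>2 + t\<^sup>2) = r" for t
    using real_sqrt_eq_iff[of "r\<^sup>2 + t\<^sup>2" "r\<^sup>2"] that r_pos by simp
  then have iff: "?P + t *\<^sub>R ?v \<in> sphere c r \<longleftrightarrow> t = 0" for t
    using nrm[of t] nrm[of 0] r_pos by (simp only: mem_sphere) auto
  show "range (\<lambda>t. ?P + t *\<^sub>R ?v) \<inter> sphere c r = {?P}"
  proof (intro equalityI subsetI)
    fix x assume "x \<in> range (\<lambda>t. ?P + t *\<^sub>R ?v) \<inter> sphere c r"
    then obtain t where "x = ?P + t *\<^sub>R ?v" "x \<in> sphere c r" by blast
    then show "x \<in> {?P}" using iff by (metis add.right_neutral scaleR_zero_left singletonI)
  next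
    fix x assume "x \<in> {?P}"
    then have "x = ?P + 0 *\<^sub>R ?v" by simp
    then show "x \<in> range (\<lambda>t. ?P + t *\<^sub>R ?v) \<inter> sphere c r" using iff by blast
  qed
qed

text \<open>
  With a the tangent length and u = z / (r - i a), the contact point is r u and z lies at r u - i a u;
  the opposite end of the chord is r u + i (lam / a) u.
\<close>

definition step :: "complex \<Rightarrow> complex" where
  "step z = z * Complex r (lam / tan_len z) / Complex r (- tan_len z)"

text \<open>The tangent from \<open>z\<close> passes its contact point, which is interior, and
  leaves \<open>K\<close> at some distance \<open>b > 0\<close> behind it. The power condition gives
  \<open>a * b = lam\<close>, which locates that end and makes \<open>lam\<close> positive.\<close>

lemma step_bd:
  assumes "z \<in> bd"
  shows "step z \<in> bd" and "0 < lam"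
proof -
  define a where "a = tan_len z"
  have a: "0 < a" "(norm z)\<^sup>2 = r\<^sup>2 + a\<^sup>2"
    using assms tan_len_pos norm_sq_bd by (auto simp: a_def)
  define u where "u = z / Complex r (- a)"
  have n0: "Complex r (- a) \<noteq> 0" using r_pos by (simp add: complex_eq_iff)
  have nz: "norm z = sqrt (r\<^sup>2 + a\<^sup>2)" using a(2) by (metis norm_ge_zero real_sqrt_unique)
  have "0 < r\<^sup>2 + a\<^sup>2" using r_pos by (simp add: add_pos_nonneg)
  then have u: "norm u = 1"
    using a(1) by (simp add: u_def norm_divide nz complex_norm)
  define P where "P = c + plane (r * u)"
  define v where "v = plane (\<i> * u)"
  have nv: "norm v = 1" using u by (simp add: v_def norm_mult)
  have z: "z = r * u - a *\<^sub>R (\<i> * u)"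
  proof -
    have "z = Complex r (- a) * u" using n0 by (simp add: u_def)
    also have "\<dots> = r * u - a *\<^sub>R (\<i> * u)"
      by (simp add: complex_eq_iff)
    finally show ?thesis .
  qed
  have "P - a *\<^sub>R v = c + plane z"
    unfolding P_def v_def using arg_cong[OF z, of plane] by (simp add: plane_diff plane_scaleR)
  then have A: "P - a *\<^sub>R v \<in> frontier K" using assms by (simp add: bd_def)
  have "P \<in> sphere c r" using u r_pos by (simp add: P_def dist_norm norm_mult)
  then have P: "P \<in> interior K" using sphere_sub by blast
  have "v \<noteq> 0" using nv by (metis norm_zero zero_neq_one)
  then obtain b where b: "0 < b" "P + b *\<^sub>R v \<in> frontier K"
    using ray_to_frontier[OF K_props(4) P] by blast
  have "dist (P - a *\<^sub>R v) P * dist P (P + b *\<^sub>R v) = lam"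
    using power[OF tangent_line_at_sphere[OF u] _ _
        chord_through_interior[OF K_props(1,3), of "c + plane (r * u)" a "plane (\<i> * u)" b]]
      A b a(1) P unfolding P_def v_def by simp
  then have ab: "a * b = lam" using a(1) b(1) nv by (simp add: dist_norm)
  then show "0 < lam" using a b by auto
  have bl: "b = lam / a" using ab a by (simp add: field_simps)
  have "step z = u * Complex r b"
    by (simp add: step_def u_def bl a_def)
  also have "\<dots> = r * u + b *\<^sub>R (\<i> * u)" by (simp add: complex_eq_iff algebra_simps)
  finally have "c + plane (step z) = P + b *\<^sub>R v"
    by (simp add: P_def v_def plane_add plane_scaleR)
  then show "step z \<in> bd" using b by (simp add: bd_def)
qed

lemma lam_pos: "0 < lam"
  using bd_nonempty step_bd(2) by blast

text \<open>The norm of \<open>z\<close> equals that of the denominator in \<open>step\<close>, so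
  \<open>step z\<close> has the norm of \<open>Complex r (lam / tan_len z)\<close>.\<close>

lemma tan_len_step:
  assumes "z \<in> bd"
  shows "tan_len (step z) = lam / tan_len z"
proof -
  have a: "0 < tan_len z" "norm z = sqrt (r\<^sup>2 + (tan_len z)\<^sup>2)"
    using assms tan_len_pos norm_sq_bd by (auto, metis norm_ge_zero real_sqrt_unique)
  have "r\<^sup>2 + (tan_len z)\<^sup>2 > 0" using r_pos by (simp add: add_pos_nonneg)
  then have "norm (step z) = sqrt (r\<^sup>2 + (lam / tan_len z)\<^sup>2)"
    using a(1) by (simp only: step_def norm_mult norm_divide complex_norm a(2)) simp
  then have "tan_len (step z) = \<bar>lam / tan_len z\<bar>"
    by (simp add: tan_len_def[of "step z"])
  then show ?thesis
    using a(1) lam_pos by simp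
qed

text \<open>The product (r + i a) (r + i lam / a), whose argument is half the angle of the double step.\<close>

definition zeta :: "complex \<Rightarrow> complex" where
  "zeta z = Complex (r\<^sup>2 - lam) (r * (tan_len z + lam / tan_len z))"

lemma zeta_nz: "z \<in> bd \<Longrightarrow> zeta z \<noteq> 0"
  using tan_len_pos[of z] r_pos lam_pos by (simp add: zeta_def complex_eq_iff add_pos_pos less_imp_neq[symmetric])

text \<open>For nonzero \<open>zeta z\<close> this is the unit number with twice its
  argument.\<close>

definition rot :: "complex \<Rightarrow> complex" where
  "rot z = zeta z / cnj (zeta z)"

lemma norm_rot: "z \<in> bd \<Longrightarrow> norm (rot z) = 1"
  using zeta_nz[of z] by (simp add: rot_def norm_divide)

text \<open>The second step interchanges the tangent lengths \<open>a\<close> and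
  \<open>b = lam / a\<close>. Hence the two numerators multiply to \<open>zeta z\<close> and the two
  denominators to its conjugate.\<close>

lemma step_step:
  assumes "z \<in> bd"
  shows "step (step z) = z * rot z"
proof -
  define a b where "a = tan_len z" and "b = lam / a"
  have a: "a > 0" and b: "b > 0" and ab: "lam = a * b" and lb: "lam / b = a"
    using tan_len_pos[OF assms] lam_pos by (auto simp: a_def b_def)
  have "step (step z) = (z * Complex r b / Complex r (- a)) * Complex r a / Complex r (- b)"
    by (simp add: step_def[of "step z"] tan_len_step[OF assms] flip: a_def b_def)
       (simp add: step_def lb flip: a_def b_def)
  also have "\<dots> = z * ((Complex r a * Complex r b) / (Complex r (- a) * Complex r (- b)))"
    by (simp add: field_simps)
  also have "Complex r a * Complex r b = zeta z"
    by (simp add: zeta_def flip: a_def b_def) (simp add: complex_eq_iff ab power2_eq_square algebra_simps)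
  also have "Complex r (- a) * Complex r (- b) = cnj (zeta z)"
    by (simp add: zeta_def flip: a_def b_def) (simp add: complex_eq_iff ab power2_eq_square algebra_simps)
  finally show ?thesis by (simp add: rot_def)
qed

text \<open>\<open>rot\<close> depends on its argument only through the norm, so the same factor
  \<open>rot z\<close> serves along the whole orbit.\<close>

lemma orbit_bd:
  assumes "z \<in> bd"
  shows "z * rot z ^ n \<in> bd"
proof (induction n)
  case 0
  then show ?case using assms by simp
next
  case (Suc n)
  have "norm (z * rot z ^ n) = norm z"
    using norm_rot[OF assms] by (simp add: norm_mult norm_power)
  then have "rot (z * rot z ^ n) = rot z"
    by (simp add: rot_def zeta_def tan_len_def)
  moreover have "step (step (z * rot z ^ n)) \<in> bd"
    using Suc step_bd(1) by blast
  ultimately show ?case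
    using step_step[OF Suc] by (simp add: mult_ac)
qed

section \<open>Recognizing a disc, and the case \<open>lam \<noteq> r\<^sup>2\<close>\<close>

text \<open>On each ray from \<open>c\<close> there is a frontier point at distance
  \<open>norm z\<close>. Convexity puts everything before it into \<open>K\<close>, and the ray
  comparison excludes everything after it.\<close>

lemma disc_if_sphere:
  assumes "z \<in> bd" "sphere 0 (norm z) \<subseteq> bd"
  shows "is_disc K"
proof -
  have R: "0 < norm z" using norm_bd[OF assms(1)] r_pos by linarith
  have "x \<in> K \<longleftrightarrow> x \<in> cball c (norm z)" for x
  proof (cases "x = c")
    case True
    then show ?thesis using center_interior interior_subset[of K] by auto
  next
    case False
    define t where "t = norm (x - c) / norm z"
    define y where "y = (norm z / norm (x - c)) *\<^sub>R (x - c)"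
    have t: "0 < t" and x: "x = c + t *\<^sub>R y" using False R by (auto simp: t_def y_def)
    have "norm (plane_inv y) = norm z"
      using R False norm_plane[of "plane_inv y"] by (simp add: y_def)
    then have y: "c + 1 *\<^sub>R y \<in> frontier K" using assms(2) by (auto simp: bd_def)
    then have yK: "c + y \<in> K" using K_props by (auto simp: frontier_def)
    have iff: "x \<in> cball c (norm z) \<longleftrightarrow> t \<le> 1"
      using R by (simp add: t_def dist_norm norm_minus_commute)
    show ?thesis
    proof
      assume "x \<in> K"
      then show "x \<in> cball c (norm z)"
        using ray_in_convex_le_frontier[OF K_props(1) center_interior, of t y 1] y x iff by simp
    next
      assume "x \<in> cball c (norm z)"
      then have "t \<le> 1" using iff by simp
      then have "(1 - t) *\<^sub>R c + t *\<^sub>R (c + y) \<in> K"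
        using convexD[OF K_props(1), of c "c + y" "1 - t" t] t yK center_interior interior_subset[of K] by auto
      then show "x \<in> K" by (simp add: x algebra_simps)
    qed
  qed
  then show ?thesis unfolding is_disc_def using R by blast
qed

lemma continuous_tan_len: "continuous_on A tan_len"
  unfolding tan_len_def by (intro continuous_intros)

lemma continuous_rot: "continuous_on bd rot"
proof -
  have "continuous_on bd zeta"
    unfolding zeta_def Complex_eq
    by (intro continuous_intros continuous_tan_len) (use tan_len_pos in force)
  then show ?thesis
    unfolding rot_def by (intro continuous_intros) (use zeta_nz in auto)
qed

text \<open>Boundedness makes every ray from the centre meet the boundary, necessarily at the common
  norm, so a full circle lies in the boundary.\<close>

lemma disc_if_constant_norm:
  assumes "\<And>z w. z \<in> bd \<Longrightarrow> w \<in> bd \<Longrightarrow> norm z = norm w"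
  shows "is_disc K"
proof -
  obtain z where z: "z \<in> bd" using bd_nonempty by blast
  have "y \<in> bd" if "norm y = norm z" for y
  proof -
    have "0 < norm z" using norm_bd[OF z] r_pos by linarith
    then have "plane y \<noteq> 0" using that by (metis norm_plane norm_zero less_irrefl)
    then obtain d where d: "0 < d" "c + d *\<^sub>R plane y \<in> frontier K"
      using ray_to_frontier[OF K_props(4) center_interior] by blast
    then have dy: "d *\<^sub>R y \<in> bd" by (simp add: bd_def plane_scaleR)
    then have "norm (d *\<^sub>R y) = norm y" using assms[OF _ z] that by metis
    then have "d = 1" using d(1) \<open>0 < norm z\<close> that by simp
    then show ?thesis using dy by simp
  qed
  then show ?thesis using disc_if_sphere[OF z] by (simp add: subset_iff)
qed

text \<open>With constant \<open>rot\<close>, all values of \<open>zeta\<close> lie on one real line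
  through 0. Their common real part \<open>r\<^sup>2 - lam\<close> is nonzero, so the imaginary
  parts agree, and each tangent length solves one fixed quadratic equation.\<close>

lemma rot_not_constant:
  assumes "lam \<noteq> r\<^sup>2" "z \<in> bd" "w \<in> bd" "norm z \<noteq> norm w"
  shows "\<exists>z'\<in>bd. \<exists>w'\<in>bd. rot z' \<noteq> rot w'"
proof (rule ccontr)
  assume neg: "\<not> (\<exists>z'\<in>bd. \<exists>w'\<in>bd. rot z' \<noteq> rot w')"
  have root: "(tan_len y)\<^sup>2 + lam = (tan_len z + lam / tan_len z) * tan_len y" if y: "y \<in> bd" for y
  proof -
    have "rot y = rot z" using neg assms(2) y by blast
    then have "zeta y * cnj (zeta z) = zeta z * cnj (zeta y)"
      using zeta_nz y assms(2) by (simp add: rot_def field_simps)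
    then have "Im (zeta y) * Re (zeta z) = Im (zeta z) * Re (zeta y)"
      by (simp add: complex_eq_iff algebra_simps)
    then have "tan_len y + lam / tan_len y = tan_len z + lam / tan_len z"
      using assms(1) r_pos by (simp add: zeta_def)
    then show ?thesis
      using tan_len_pos[OF y] by (metis add_divide_distrib nonzero_divide_eq_eq less_imp_neq[symmetric]
         distrib_right power2_eq_square times_divide_eq_left nonzero_mult_div_cancel_right)
  qed
  have "tan_len y \<in> {tan_len z, lam / tan_len z}" if y: "y \<in> bd" for y
  proof -
    \<comment> \<open>One root of the quadratic is \<open>tan_len z\<close>; the product of the
      roots is \<open>lam\<close>.\<close>
    have "(tan_len y - tan_len z) * (tan_len y - lam / tan_len z) = 0"
      using root[OF y] tan_len_pos[OF assms(2)] by (simp add: algebra_simps power2_eq_square)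
    then show ?thesis by auto
  qed
  then have "tan_len ` bd \<subseteq> {tan_len z, lam / tan_len z}"
    by (rule image_subsetI)
  then have "finite (tan_len ` bd)"
    by (rule finite_subset) simp
  moreover have "connected (tan_len ` bd)"
    using bd_connected continuous_tan_len connected_continuous_image by blast
  ultimately obtain s where "tan_len ` bd = {s}"
    using connected_finite_iff_sing assms(2) by blast
  then have "tan_len z = tan_len w" using assms(2,3) by (metis imageI singletonD)
  then have "(norm z)\<^sup>2 = (norm w)\<^sup>2" using norm_sq_bd assms(2,3) by simp
  then show False using assms(4) by simp
qed

lemma disc_if_lam_neq:
  assumes "lam \<noteq> r\<^sup>2"
  shows "is_disc K"
proof (rule ccontr)
  assume nd: "\<not> is_disc K"
  then obtain z w where "z \<in> bd" "w \<in> bd" "norm z \<noteq> norm w"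
    using disc_if_constant_norm by blast
  then obtain z w where zw: "z \<in> bd" "w \<in> bd" "rot z \<noteq> rot w"
    using rot_not_constant[OF assms] by blast
  \<comment> \<open>A connected set with two points is uncountable, while the roots of unity are
    countable; so some boundary point is turned by a rotation of infinite order.\<close>
  have "uncountable (rot ` bd)"
    using connected_uncountable[of "rot ` bd" "rot z" "rot w"] zw
      connected_continuous_image[OF continuous_rot bd_connected] by blast
  then have "\<not> rot ` bd \<subseteq> {w. \<exists>n>0. w ^ n = 1}"
    using countable_complex_roots_of_unity countable_subset by blast
  then obtain y where y: "y \<in> bd" "\<And>n. n > 0 \<Longrightarrow> rot y ^ n \<noteq> 1" by blast
  have "sphere 0 (norm y) \<subseteq> bd"
    using closed_unit_orbit_dense[OF norm_rot[OF y(1)] y(2)] bd_compact orbit_bd[OF y(1)]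
    by (simp add: compact_imp_closed)
  then show False using disc_if_sphere y nd by blast
qed

section \<open>The case \<open>lam = r\<^sup>2\<close>\<close>

text \<open>Here \<open>zeta z\<close> is purely imaginary, so its quotient by its conjugate is
  -1.\<close>

lemma uminus_bd:
  assumes "lam = r\<^sup>2" "z \<in> bd"
  shows "- z \<in> bd"
proof -
  have "Re (zeta z) = 0" unfolding zeta_def using assms(1) by simp
  then have "cnj (zeta z) = - zeta z" by (simp add: complex_eq_iff)
  then have "rot z = - 1" using zeta_nz[OF assms(2)] by (simp add: rot_def)
  then show ?thesis using orbit_bd[OF assms(2), of 1] by simp
qed

text \<open>With \<open>a = tan_len z\<close>, the numerator
  \<open>Complex r (r\<^sup>2 / a)\<close> is \<open>\<i> * (r / a)\<close> times the denominator
  \<open>Complex r (- a)\<close>, which cancels.\<close>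

lemma quarter_turn_bd:
  assumes "lam = r\<^sup>2" "z \<in> bd"
  shows "(r / tan_len z) *\<^sub>R (\<i> * z) \<in> bd"
proof -
  have a: "0 < tan_len z" using tan_len_pos[OF assms(2)] .
  have "Complex r (lam / tan_len z) = (r / tan_len z) *\<^sub>R (\<i> * Complex r (- tan_len z))"
    using a assms(1) by (simp add: complex_eq_iff power2_eq_square)
  moreover have "Complex r (- tan_len z) \<noteq> 0" using r_pos by (simp add: complex_eq_iff)
  ultimately have "step z = (r / tan_len z) *\<^sub>R (\<i> * z)"
    by (simp add: step_def field_simps)
  then show ?thesis using step_bd(1)[OF assms(2)] by simp
qed

end

section \<open>Comparison of two equipotential circles\<close>

lemma equipotential_circleE:
  assumes "convex_body K" "equipotential_circle K \<Omega>"
  obtains c r lam where "\<Omega> = sphere c r" "equipotential K c r lam"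
  using assms unfolding equipotential_circle_def is_circle_def equipotential_def by metis

text \<open>Iteration puts all \<open>x + real n *\<^sub>R d\<close> into \<open>S\<close>, and
  these are unbounded unless \<open>d\<close> vanishes.\<close>

lemma bounded_translation_invariant:
  fixes S :: "'a::real_normed_vector set"
  assumes "bounded S" "S \<noteq> {}" "\<And>x. x \<in> S \<Longrightarrow> x + d \<in> S"
  shows "d = 0"
proof (rule ccontr)
  assume "d \<noteq> 0"
  obtain x where "x \<in> S" using assms(2) by blast
  have orb: "x + real n *\<^sub>R d \<in> S" for n
  proof (induction n)
    case (Suc n)
    then show ?case using assms(3)[OF Suc] by (simp add: scaleR_add_left add_ac)
  qed (simp add: \<open>x \<in> S\<close>)
  obtain B where B: "\<And>y. y \<in> S \<Longrightarrow> norm y \<le> B" using assms(1) bounded_iff by blast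
  obtain n where n: "real n * norm d > B + norm x"
    using \<open>d \<noteq> 0\<close> reals_Archimedean3[of "norm d"] by auto
  have "norm (real n *\<^sub>R d) \<le> norm (x + real n *\<^sub>R d) + norm x"
    using norm_triangle_ineq4[of "x + real n *\<^sub>R d" x] by simp
  then show False using B[OF orb[of n]] n by simp
qed

theorem theorem2:
  fixes K \<Omega>\<^sub>1 \<Omega>\<^sub>2 :: "(real^2) set"
  assumes "convex_body K"
    and "equipotential_circle K \<Omega>\<^sub>1"
    and "equipotential_circle K \<Omega>\<^sub>2"
    and "\<Omega>\<^sub>1 \<noteq> \<Omega>\<^sub>2"
  shows "is_disc K"
proof (rule ccontr)
  assume nd: "\<not> is_disc K"
  obtain c r lam where 1: "\<Omega>\<^sub>1 = sphere c r" "equipotential K c r lam"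
    using equipotential_circleE assms(1,2) by blast
  obtain c' r' lam' where 2: "\<Omega>\<^sub>2 = sphere c' r'" "equipotential K c' r' lam'"
    using equipotential_circleE assms(1,3) by blast
  interpret A: equipotential K c r lam by fact
  interpret B: equipotential K c' r' lam' by fact
  have lam: "lam = r\<^sup>2" "lam' = r'\<^sup>2"
    using A.disc_if_lam_neq B.disc_if_lam_neq nd by auto
  have sym: "2 *\<^sub>R c - x \<in> frontier K" "2 *\<^sub>R c' - x \<in> frontier K" if x: "x \<in> frontier K" for x
  proof -
    have "plane_inv (x - c) \<in> A.bd" using x by (simp add: A.bd_def)
    from A.uminus_bd[OF lam(1) this] show "2 *\<^sub>R c - x \<in> frontier K"
      by (simp add: A.bd_def plane_minus algebra_simps scaleR_2)
    have "plane_inv (x - c') \<in> B.bd" using x by (simp add: B.bd_def)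
    from B.uminus_bd[OF lam(2) this] show "2 *\<^sub>R c' - x \<in> frontier K"
      by (simp add: B.bd_def plane_minus algebra_simps scaleR_2)
  qed
  \<comment> \<open>The point reflection in \<open>c\<close> followed by that in \<open>c'\<close>
    is the translation by this vector, and it preserves the bounded frontier.\<close>
  have "2 *\<^sub>R (c' - c) = 0"
  proof (rule bounded_translation_invariant)
    show "bounded (frontier K)"
      using A.K_props by (simp add: compact_frontier compact_imp_bounded)
    show "frontier K \<noteq> {}" using A.bd_nonempty by (auto simp: A.bd_def)
    fix x assume "x \<in> frontier K"
    then have "2 *\<^sub>R c' - (2 *\<^sub>R c - x) \<in> frontier K" using sym by blast
    then show "x + 2 *\<^sub>R (c' - c) \<in> frontier K" by (simp add: algebra_simps)
  qed
  then have c: "c' = c" by simp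
  obtain z where z: "z \<in> A.bd" using A.bd_nonempty by blast
  have bd: "B.bd = A.bd" by (simp add: A.bd_def B.bd_def c)
  \<comment> \<open>These are the dilation factors of the two quarter turns of the same point
    \<open>z\<close>. Both images lie on the ray through \<open>\<i> * z\<close>, hence
    coincide.\<close>
  define s s' where "s = r / A.tan_len z" and "s' = r' / B.tan_len z"
  have pos: "0 < A.tan_len z" "0 < B.tan_len z"
    using A.tan_len_pos B.tan_len_pos z bd by auto
  have s: "0 < s" "0 < s'" using pos A.r_pos B.r_pos by (auto simp: s_def s'_def)
  have "s *\<^sub>R (\<i> * z) \<in> A.bd" "s' *\<^sub>R (\<i> * z) \<in> A.bd"
    using A.quarter_turn_bd[OF lam(1) z] B.quarter_turn_bd[OF lam(2)] z bd by (auto simp: s_def s'_def)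
  then have "s' / s = 1"
    using A.bd_ray_unique[of "s *\<^sub>R (\<i> * z)" "s' / s"] s by simp
  then have "r * B.tan_len z = r' * A.tan_len z"
    using s pos by (simp add: s_def s'_def field_simps)
  then have "r\<^sup>2 * (B.tan_len z)\<^sup>2 = r'\<^sup>2 * (A.tan_len z)\<^sup>2"
    by (metis power_mult_distrib)
  \<comment> \<open>After substitution the term \<open>r\<^sup>2 * r'\<^sup>2\<close> stands on both
    sides and cancels.\<close>
  moreover have "(A.tan_len z)\<^sup>2 = (norm z)\<^sup>2 - r\<^sup>2" "(B.tan_len z)\<^sup>2 = (norm z)\<^sup>2 - r'\<^sup>2"
    using A.norm_sq_bd[OF z] B.norm_sq_bd z bd by auto
  ultimately have "r\<^sup>2 * (norm z)\<^sup>2 = r'\<^sup>2 * (norm z)\<^sup>2"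
    by (simp add: algebra_simps)
  moreover have "norm z > 0" using A.norm_bd[OF z] A.r_pos by linarith
  ultimately have "r = r'"
    using A.r_pos B.r_pos by (simp add: power2_eq_iff_nonneg)
  then show False using 1 2 c assms(4) by simp
qed

end
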